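(* There is a polynomial-time algorithm that, given a weighted house allocation instance $\langle N,H,V\rangle$ with $m\le n$, computes a complete allocation that minimizes the number of envious agents $\#\mathrm{envy}(A)$ among all complete allocations $A$.
   Context: A house allocation instance $\langle N,H,V\rangle$ consists of a finite set $N$ of $n$ agents, a finite set $H$ of $m$ houses, and for each agent $i\in N$ a valuation $v_i:H\to\mathbb{R}_{\ge 0}$, with the convention $v_i(\emptyset)=0$. A weighted instance allows arbitrary non-negative values. An allocation $A$ assigns to each agent $i$ either one house $A(i)\in H$ or nothing ($A(i)=\emptyset$), with each house assigned to at most one agent; an agent may be assigned a house it values at zero. An allocation is complete if every agent is assigned a house (when $m\ge n$), or every house is assigned to an agent (when $m<n$). Agent $i$ envies agent $j$ in $A$ if $v_i(A(j))>v_i(A(i))$; $\#\mathrm{envy}(A)$ is the number of agents that envy some agent. *)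

theory Defs
  imports Complex_Main "HOL-Computational_Algebra.Polynomial"
begin

section \<open>House allocation\<close>

definition house_instance :: "'a set \<Rightarrow> 'b set \<Rightarrow> ('a \<Rightarrow> 'b \<Rightarrow> real) \<Rightarrow> bool" where
  "house_instance N H v \<longleftrightarrow> finite N \<and> finite H \<and> (\<forall>i\<in>N. \<forall>h\<in>H. 0 \<le> v i h)"

text \<open>An allocation is a partial map from agents to houses; \<open>None\<close> plays the role of the empty
  bundle, which has value 0.\<close>

definition allocation :: "'a set \<Rightarrow> 'b set \<Rightarrow> ('a \<rightharpoonup> 'b) \<Rightarrow> bool" where
  "allocation N H A \<longleftrightarrow> dom A \<subseteq> N \<and> ran A \<subseteq> H \<and> inj_on A (dom A)"

definition complete_allocation :: "'a set \<Rightarrow> 'b set \<Rightarrow> ('a \<rightharpoonup> 'b) \<Rightarrow> bool" where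
  "complete_allocation N H A \<longleftrightarrow> allocation N H A \<and>
     (if card N \<le> card H then dom A = N else ran A = H)"

fun bundle_value :: "('a \<Rightarrow> 'b \<Rightarrow> real) \<Rightarrow> 'a \<Rightarrow> 'b option \<Rightarrow> real" where
  "bundle_value v i None = 0"
| "bundle_value v i (Some h) = v i h"

definition envies :: "('a \<Rightarrow> 'b \<Rightarrow> real) \<Rightarrow> ('a \<rightharpoonup> 'b) \<Rightarrow> 'a \<Rightarrow> 'a \<Rightarrow> bool" where
  "envies v A i j \<longleftrightarrow> bundle_value v i (A j) > bundle_value v i (A i)"

definition num_envy :: "'a set \<Rightarrow> ('a \<Rightarrow> 'b \<Rightarrow> real) \<Rightarrow> ('a \<rightharpoonup> 'b) \<Rightarrow> nat" where
  "num_envy N v A = card {i \<in> N. \<exists>j\<in>N. envies v A i j}"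

definition min_envy_complete ::
    "'a set \<Rightarrow> 'b set \<Rightarrow> ('a \<Rightarrow> 'b \<Rightarrow> real) \<Rightarrow> ('a \<rightharpoonup> 'b) \<Rightarrow> bool" where
  "min_envy_complete N H v A \<longleftrightarrow> complete_allocation N H A \<and>
     (\<forall>B. complete_allocation N H B \<longrightarrow> num_envy N v A \<le> num_envy N v B)"


section \<open>Algorithms and their running time\<close>

text \<open>Algorithms are programs of a while language over a random access memory consisting of named
  arrays of natural numbers and named arrays of reals (a scalar variable is an array of which only
  cell 0 is used). Every elementary operation costs one time unit.

  Arithmetic is restricted to addition, subtraction and comparison, all constants are natural or
  rational numbers, and reals influence the computation only through comparisons. Hence a unit-cost
  step is honest: on rational inputs, \<open>t\<close> steps lengthen the binary representation of the numbers
  in memory by only \<open>O(t)\<close> bits beyond that of the input (over a common denominator), so a program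
  running in polynomially many steps is simulated by a Turing machine in time polynomial in the bit
  length of the input. With unit-cost multiplication, or with arbitrary real constants, this would
  fail.\<close>

type_synonym vname = string

record state =
  nmem :: "vname \<Rightarrow> nat \<Rightarrow> nat"
  rmem :: "vname \<Rightarrow> nat \<Rightarrow> real"

datatype nexp =
    NConst nat
  | NGet vname nexp
  | NPlus nexp nexp
  | NMinus nexp nexp

datatype rexp =
    RConst rat
  | RGet vname nexp
  | RPlus rexp rexp
  | RMinus rexp rexp

datatype bexp =
    NLess nexp nexp
  | RLess rexp rexp
  | Not bexp
  | And bexp bexp

datatype com =
    Skip
  | NStore vname nexp nexp
  | RStore vname nexp rexp
  | Seq com com
  | If bexp com com
  | While bexp com

fun nval :: "nexp \<Rightarrow> state \<Rightarrow> nat" where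
  "nval (NConst k) s = k"
| "nval (NGet x a) s = nmem s x (nval a s)"
| "nval (NPlus a b) s = nval a s + nval b s"
| "nval (NMinus a b) s = nval a s - nval b s"

fun rval :: "rexp \<Rightarrow> state \<Rightarrow> real" where
  "rval (RConst q) s = of_rat q"
| "rval (RGet x a) s = rmem s x (nval a s)"
| "rval (RPlus a b) s = rval a s + rval b s"
| "rval (RMinus a b) s = rval a s - rval b s"

fun bval :: "bexp \<Rightarrow> state \<Rightarrow> bool" where
  "bval (NLess a b) s \<longleftrightarrow> nval a s < nval b s"
| "bval (RLess a b) s \<longleftrightarrow> rval a s < rval b s"
| "bval (Not b) s \<longleftrightarrow> \<not> bval b s"
| "bval (And b c) s \<longleftrightarrow> bval b s \<and> bval c s"

fun ncost :: "nexp \<Rightarrow> nat" where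
  "ncost (NConst k) = 1"
| "ncost (NGet x a) = 1 + ncost a"
| "ncost (NPlus a b) = 1 + ncost a + ncost b"
| "ncost (NMinus a b) = 1 + ncost a + ncost b"

fun rcost :: "rexp \<Rightarrow> nat" where
  "rcost (RConst q) = 1"
| "rcost (RGet x a) = 1 + ncost a"
| "rcost (RPlus a b) = 1 + rcost a + rcost b"
| "rcost (RMinus a b) = 1 + rcost a + rcost b"

fun bcost :: "bexp \<Rightarrow> nat" where
  "bcost (NLess a b) = 1 + ncost a + ncost b"
| "bcost (RLess a b) = 1 + rcost a + rcost b"
| "bcost (Not b) = 1 + bcost b"
| "bcost (And b c) = 1 + bcost b + bcost c"

definition nstore :: "vname \<Rightarrow> nat \<Rightarrow> nat \<Rightarrow> state \<Rightarrow> state" where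
  "nstore x k y s = s\<lparr>nmem := (nmem s)(x := (nmem s x)(k := y))\<rparr>"

definition rstore :: "vname \<Rightarrow> nat \<Rightarrow> real \<Rightarrow> state \<Rightarrow> state" where
  "rstore x k y s = s\<lparr>rmem := (rmem s)(x := (rmem s x)(k := y))\<rparr>"

text \<open>\<open>exec c s t s'\<close>: started in \<open>s\<close>, the program \<open>c\<close> terminates in \<open>s'\<close> after exactly
  \<open>t\<close> time units.\<close>

inductive exec :: "com \<Rightarrow> state \<Rightarrow> nat \<Rightarrow> state \<Rightarrow> bool" where
  Skip: "exec Skip s 1 s"
| NStore: "exec (NStore x a e) s (1 + ncost a + ncost e) (nstore x (nval a s) (nval e s) s)"
| RStore: "exec (RStore x a e) s (1 + ncost a + rcost e) (rstore x (nval a s) (rval e s) s)"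
| Seq: "exec c s t s' \<Longrightarrow> exec d s' t' s'' \<Longrightarrow> exec (Seq c d) s (t + t') s''"
| IfTrue: "bval b s \<Longrightarrow> exec c s t s' \<Longrightarrow> exec (If b c d) s (1 + bcost b + t) s'"
| IfFalse: "\<not> bval b s \<Longrightarrow> exec d s t s' \<Longrightarrow> exec (If b c d) s (1 + bcost b + t) s'"
| WhileFalse: "\<not> bval b s \<Longrightarrow> exec (While b c) s (1 + bcost b) s"
| WhileTrue: "bval b s \<Longrightarrow> exec c s t s' \<Longrightarrow> exec (While b c) s' t' s'' \<Longrightarrow>
    exec (While b c) s (1 + bcost b + t + t') s''"

inductive_cases SkipE: "exec Skip s t s'"
  and NStoreE: "exec (NStore x a e) s t s'"
  and RStoreE: "exec (RStore x a e) s t s'"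
  and SeqE: "exec (Seq c d) s t s'"
  and IfE: "exec (If b c d) s t s'"
  and WhileE: "exec (While b c) s t s'"

lemma exec_deterministic:
  assumes "exec c s t s'" and "exec c s u s''"
  shows "t = u \<and> s' = s''"
  using assms
proof (induction arbitrary: u s'' rule: exec.induct)
  case (Skip s)
  then show ?case by (auto elim!: SkipE)
next
  case (NStore x a e s)
  then show ?case by (auto elim!: NStoreE)
next
  case (RStore x a e s)
  then show ?case by (auto elim!: RStoreE)
next
  case (Seq c s t s1 d t' s2)
  from Seq.prems obtain w r w' where "u = w + w'" "exec c s w r" "exec d r w' s''"
    by (elim SeqE) simp
  with Seq.IH(1)[of w r] Seq.IH(2)[of w' s''] show ?case by simp
next
  case (IfTrue b s c t s1 d)
  from IfTrue.prems IfTrue.hyps(1) obtain w where "u = 1 + bcost b + w" "exec c s w s''"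
    by (elim IfE) simp_all
  with IfTrue.IH[of w s''] show ?case by simp
next
  case (IfFalse b s d t s1 c)
  from IfFalse.prems IfFalse.hyps(1) obtain w where "u = 1 + bcost b + w" "exec d s w s''"
    by (elim IfE) simp_all
  with IfFalse.IH[of w s''] show ?case by simp
next
  case (WhileFalse b s c)
  from WhileFalse.prems show ?case by (rule WhileE) (use WhileFalse.hyps in simp_all)
next
  case (WhileTrue b s c t s1 t' s2)
  from WhileTrue.prems obtain w r w'
    where "u = 1 + bcost b + w + w'" "exec c s w r" "exec (While b c) r w' s''"
    by (rule WhileE) (use WhileTrue.hyps(1) in simp_all)
  with WhileTrue.IH(1)[of w r] WhileTrue.IH(2)[of w' s''] show ?case by simp
qed


section \<open>Input and output\<close>

text \<open>As input of an algorithm, the agents are numbered \<open>0, \<dots>, n - 1\<close> and the houses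
  \<open>0, \<dots>, m - 1\<close>, and the valuations are stored row by row, \<open>v i h\<close> in cell \<open>i * m + h\<close>.
  All remaining memory is 0. We measure the size of an instance by \<open>n + m\<close>, which is
  polynomially related to the number \<open>n + m + n * m\<close> of agents, houses and values.\<close>

definition input_state :: "nat \<Rightarrow> nat \<Rightarrow> (nat \<Rightarrow> nat \<Rightarrow> real) \<Rightarrow> state" where
  "input_state n m v = \<lparr>
     nmem = (\<lambda>x k. if x = ''n'' \<and> k = 0 then n else if x = ''m'' \<and> k = 0 then m else 0),
     rmem = (\<lambda>x k. if x = ''v'' \<and> k < n * m then v (k div m) (k mod m) else 0)\<rparr>"

text \<open>In the output, cell \<open>i\<close> of array \<open>A\<close> holds 0 if agent \<open>i\<close> gets nothing, and \<open>h + 1\<close>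
  if agent \<open>i\<close> gets house \<open>h\<close>.\<close>

definition output_allocation :: "nat \<Rightarrow> state \<Rightarrow> (nat \<rightharpoonup> nat)" where
  "output_allocation n s =
     (\<lambda>i. if i < n then (case nmem s ''A'' i of 0 \<Rightarrow> None | Suc h \<Rightarrow> Some h) else None)"

end

theory Submission imports Defs begin

text \<open>When every house is given away, agent \<open>i\<close> is free of envy iff \<open>i\<close> values all houses at zero or
  holds one of its favourite houses. So the task is to find a maximum matching between agents and
  their favourite houses of positive value, and then to hand out the remaining houses arbitrarily.

  The matching is found by an auction with integer prices, which needs no search for augmenting
  paths. A free agent takes the cheapest house it is adjacent to, evicts the owner and raises the
  price by one; it gives up once all its houses cost \<open>m + 2\<close>. At the end some price \<open>k\<close> with
  \<open>1 \<le> k \<le> m + 1\<close> is taken by no house. The houses dearer than \<open>k\<close> together with the owners of the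
  houses cheaper than \<open>k\<close> then cover all edges, and there are as many of them as matched pairs.\<close>

section \<open>Time-bounded Hoare triples\<close>

text \<open>Total correctness: termination is part of the claim. The bound \<open>T\<close> is a
  number and not a function of the state, so a bound depending on the instance is obtained by fixing
  \<open>n\<close> and \<open>m\<close> outside the triple.\<close>

definition hoare :: "nat \<Rightarrow> (state \<Rightarrow> bool) \<Rightarrow> com \<Rightarrow> (state \<Rightarrow> bool) \<Rightarrow> bool" where
  "hoare T P c Q \<longleftrightarrow> (\<forall>s. P s \<longrightarrow> (\<exists>t s'. exec c s t s' \<and> t \<le> T \<and> Q s'))"

lemma hoareI: "(\<And>s. P s \<Longrightarrow> \<exists>t s'. exec c s t s' \<and> t \<le> T \<and> Q s') \<Longrightarrow> hoare T P c Q"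
  by (simp add: hoare_def)

lemma hoareD: "hoare T P c Q \<Longrightarrow> P s \<Longrightarrow> \<exists>t s'. exec c s t s' \<and> t \<le> T \<and> Q s'"
  by (simp add: hoare_def)

lemma hoare_conseq:
  assumes "hoare T P c Q" "\<And>s. P' s \<Longrightarrow> P s" "\<And>s. Q s \<Longrightarrow> Q' s"
  shows "hoare T P' c Q'"
  using assms unfolding hoare_def by meson

lemma hoare_Seq:
  assumes "hoare T P c R" "hoare U R d Q"
  shows "hoare (T + U) P (Seq c d) Q"
proof (rule hoareI)
  fix s assume "P s"
  then obtain t s' where c: "exec c s t s'" "t \<le> T" "R s'" using assms(1) by (blast dest: hoareD)
  then obtain u s'' where "exec d s' u s''" "u \<le> U" "Q s''" using assms(2) by (blast dest: hoareD)
  with c show "\<exists>t s'. exec (Seq c d) s t s' \<and> t \<le> T + U \<and> Q s'"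
    by (meson exec.Seq add_mono)
qed

section \<open>Straight-line programs\<close>

fun loop_free :: "com \<Rightarrow> bool" where
  "loop_free (Seq c d) \<longleftrightarrow> loop_free c \<and> loop_free d"
| "loop_free (If b c d) \<longleftrightarrow> loop_free c \<and> loop_free d"
| "loop_free (While b c) \<longleftrightarrow> False"
| "loop_free c \<longleftrightarrow> True"

text \<open>Evaluating loop-free code as a function reduces its triples to simplification. The
  \<open>While\<close> clauses here and in \<open>max_cost\<close> are dummy values, ruled out by
  \<open>loop_free\<close> where the results are used.\<close>

fun final_state :: "com \<Rightarrow> state \<Rightarrow> state" where
  "final_state Skip s = s"
| "final_state (NStore x a e) s = nstore x (nval a s) (nval e s) s"
| "final_state (RStore x a e) s = rstore x (nval a s) (rval e s) s"
| "final_state (Seq c d) s = final_state d (final_state c s)"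
| "final_state (If b c d) s = (if bval b s then final_state c s else final_state d s)"
| "final_state (While b c) s = s"

fun max_cost :: "com \<Rightarrow> nat" where
  "max_cost Skip = 1"
| "max_cost (NStore x a e) = 1 + ncost a + ncost e"
| "max_cost (RStore x a e) = 1 + ncost a + rcost e"
| "max_cost (Seq c d) = max_cost c + max_cost d"
| "max_cost (If b c d) = 1 + bcost b + max (max_cost c) (max_cost d)"
| "max_cost (While b c) = 0"

lemma exec_loop_free: "loop_free c \<Longrightarrow> \<exists>t\<le>max_cost c. exec c s t (final_state c s)"
proof (induction c arbitrary: s)
  case (Seq c d)
  then obtain t u where "t \<le> max_cost c" "exec c s t (final_state c s)"
    "u \<le> max_cost d" "exec d (final_state c s) u (final_state d (final_state c s))"
    by (meson loop_free.simps(1))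
  then show ?case by (auto intro!: exI[of _ "t + u"] exec.Seq)
next
  case (If b c d)
  show ?case
  proof (cases "bval b s")
    case True
    obtain t where "t \<le> max_cost c" "exec c s t (final_state c s)"
      using If by (meson loop_free.simps(2))
    with True show ?thesis by (auto intro!: exI[of _ "1 + bcost b + t"] exec.IfTrue)
  next
    case False
    obtain t where "t \<le> max_cost d" "exec d s t (final_state d s)"
      using If by (meson loop_free.simps(2))
    with False show ?thesis by (auto intro!: exI[of _ "1 + bcost b + t"] exec.IfFalse)
  qed
qed (use exec.Skip exec.NStore exec.RStore in \<open>fastforce+\<close>)

lemma hoare_loop_free:
  assumes "loop_free c" "\<And>s. P s \<Longrightarrow> Q (final_state c s)"
  shows "hoare (max_cost c) P c Q"
  using exec_loop_free[OF assms(1)] assms(2) by (meson hoareI)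

text \<open>The measure bounds the number of rounds by \<open>K\<close>; the extra round in
  \<open>Suc K\<close> pays for the final failing test. The parameter \<open>k\<close> lets the
  postcondition of the body refer to the measure before the round.\<close>

lemma hoare_While:
  fixes \<mu> :: "state \<Rightarrow> nat"
  assumes body: "\<And>k. hoare T (\<lambda>s. I s \<and> bval b s \<and> \<mu> s = k) c (\<lambda>s. I s \<and> \<mu> s < k)"
    and bound: "\<And>s. I s \<Longrightarrow> \<mu> s \<le> K"
  shows "hoare (Suc K * (1 + bcost b + T)) I (While b c) (\<lambda>s. I s \<and> \<not> bval b s)"
proof -
  have "I s \<Longrightarrow> \<exists>t s'. exec (While b c) s t s' \<and> t \<le> Suc (\<mu> s) * (1 + bcost b + T) \<and>
      I s' \<and> \<not> bval b s'" for s
  proof (induction "\<mu> s" arbitrary: s rule: less_induct)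
    case less
    show ?case
    proof (cases "bval b s")
      case True
      obtain t s' where c: "exec c s t s'" "t \<le> T" "I s'" "\<mu> s' < \<mu> s"
        using hoareD[OF body, of s] True less.prems by blast
      obtain u s'' where w: "exec (While b c) s' u s''" "u \<le> Suc (\<mu> s') * (1 + bcost b + T)"
        "I s''" "\<not> bval b s''"
        using less.hyps[OF c(4,3)] by blast
      have "Suc (\<mu> s') * (1 + bcost b + T) \<le> \<mu> s * (1 + bcost b + T)"
        by (rule mult_le_mono1) (use c(4) in simp)
      then have "1 + bcost b + t + u \<le> Suc (\<mu> s) * (1 + bcost b + T)"
        using c(2) w(2) by simp
      then show ?thesis using exec.WhileTrue[OF True c(1) w(1)] w(3,4) by blast
    next
      case False
      then show ?thesis using exec.WhileFalse[OF False, of c] less.prems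
        by (intro exI[of _ "1 + bcost b"] exI[of _ s]) auto
    qed
  qed
  moreover have "Suc (\<mu> s) * (1 + bcost b + T) \<le> Suc K * (1 + bcost b + T)" if "I s" for s
    using bound[OF that] by (intro mult_le_mono1) simp
  ultimately show ?thesis unfolding hoare_def by (meson order_trans)
qed

section \<open>Counting loops\<close>

abbreviation Var :: "vname \<Rightarrow> nexp" where
  "Var x \<equiv> NGet x (NConst 0)"

abbreviation Assign :: "vname \<Rightarrow> nexp \<Rightarrow> com" where
  "Assign x e \<equiv> NStore x (NConst 0) e"

definition For :: "vname \<Rightarrow> vname \<Rightarrow> com \<Rightarrow> com" where
  "For x y c = Seq (Assign x (NConst 0))
     (While (NLess (Var x) (Var y)) (Seq c (Assign x (NPlus (Var x) (NConst 1)))))"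

lemma nmem_nstore [simp]: "nmem (nstore x k a s) = (nmem s)(x := (nmem s x)(k := a))"
  by (simp add: nstore_def)

lemma rmem_nstore [simp]: "rmem (nstore x k a s) = rmem s"
  by (simp add: nstore_def)

lemma nmem_rstore [simp]: "nmem (rstore x k a s) = nmem s"
  by (simp add: rstore_def)

lemma rmem_rstore [simp]: "rmem (rstore x k a s) = (rmem s)(x := (rmem s x)(k := a))"
  by (simp add: rstore_def)

text \<open>The increment is absorbed into the postcondition of the body, whose first conjunct
  ensures that \<open>Suc k\<close> is what gets stored. Resetting the counter costs 3; a test and
  an increment cost 6 each, hence 12.\<close>

lemma hoare_For:
  assumes init: "\<And>s. P s \<Longrightarrow> I 0 (nstore x 0 0 s)"
    and counter: "\<And>k s. I k s \<Longrightarrow> nmem s x 0 = k \<and> nmem s y 0 = N"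
    and body: "\<And>k. k < N \<Longrightarrow> hoare T (I k) c
      (\<lambda>s. nmem s x 0 = k \<and> I (Suc k) (nstore x 0 (Suc k) s))"
    and post: "\<And>s. I N s \<Longrightarrow> Q s"
  shows "hoare (3 + Suc N * (T + 12)) P (For x y c) Q"
proof -
  let ?J = "\<lambda>s. \<exists>k\<le>N. I k s"
  let ?inc = "Assign x (NPlus (Var x) (NConst 1))"
  have "hoare (T + max_cost ?inc) (\<lambda>s. ?J s \<and> bval (NLess (Var x) (Var y)) s \<and> N - nmem s x 0 = j)
      (Seq c ?inc) (\<lambda>s. ?J s \<and> N - nmem s x 0 < j)" for j
  proof (rule hoareI, elim conjE exE)
    fix s k
    assume k: "k \<le> N" "I k s" and b: "bval (NLess (Var x) (Var y)) s" "N - nmem s x 0 = j"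
    have "k < N" "j = N - k" using counter[OF k(2)] b by auto
    have "hoare (T + max_cost ?inc) (I k) (Seq c ?inc) (I (Suc k))"
      using body[OF \<open>k < N\<close>] by (rule hoare_Seq) (rule hoare_loop_free, auto)
    from hoareD[OF this k(2)] obtain t s' where
      "exec (Seq c ?inc) s t s'" "t \<le> T + max_cost ?inc" "I (Suc k) s'" by blast
    with \<open>k < N\<close> \<open>j = N - k\<close> show "\<exists>t s'. exec (Seq c ?inc) s t s' \<and> t \<le> T + max_cost ?inc \<and>
        ?J s' \<and> N - nmem s' x 0 < j"
      using counter by (intro exI[of _ t] exI[of _ s']) (auto intro!: exI[of _ "Suc k"])
  qed
  then have "hoare (Suc N * (1 + bcost (NLess (Var x) (Var y)) + (T + max_cost ?inc))) ?J
      (While (NLess (Var x) (Var y)) (Seq c ?inc))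
      (\<lambda>s. ?J s \<and> \<not> bval (NLess (Var x) (Var y)) s)"
    by (rule hoare_While) simp
  then have run: "hoare (max_cost (Assign x (NConst 0)) +
      Suc N * (1 + bcost (NLess (Var x) (Var y)) + (T + max_cost ?inc))) P (For x y c)
      (\<lambda>s. ?J s \<and> \<not> bval (NLess (Var x) (Var y)) s)"
    unfolding For_def
    by (rule hoare_Seq[rotated]) (rule hoare_loop_free, auto dest: init)
  have post': "Q s" if "?J s \<and> \<not> bval (NLess (Var x) (Var y)) s" for s
    using that counter post by fastforce
  have cost: "max_cost (Assign x (NConst 0)) +
      Suc N * (1 + bcost (NLess (Var x) (Var y)) + (T + max_cost ?inc)) = 3 + Suc N * (T + 12)"
    by (simp add: algebra_simps)
  show ?thesis by (rule hoare_conseq[OF run[unfolded cost] _ post'])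
qed

section \<open>Polynomially bounded functions\<close>

text \<open>Bounds stay functions of \<open>n\<close> and \<open>m\<close>, as the rules above
  produce them. Closure under sums and products replaces an explicit polynomial.\<close>

definition poly_bounded :: "(nat \<Rightarrow> nat \<Rightarrow> nat) \<Rightarrow> bool" where
  "poly_bounded f \<longleftrightarrow> (\<exists>p. \<forall>n m. f n m \<le> poly p (n + m))"

lemma poly_bounded_const: "poly_bounded (\<lambda>n m. c)"
  unfolding poly_bounded_def by (rule exI[of _ "[:c:]"]) simp

lemma poly_bounded_fst: "poly_bounded (\<lambda>n m. n)"
  unfolding poly_bounded_def by (rule exI[of _ "[:0, 1:]"]) simp

lemma poly_bounded_snd: "poly_bounded (\<lambda>n m. m)"
  unfolding poly_bounded_def by (rule exI[of _ "[:0, 1:]"]) simp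

lemma poly_bounded_add:
  assumes "poly_bounded f" "poly_bounded g"
  shows "poly_bounded (\<lambda>n m. f n m + g n m)"
proof -
  obtain p q where "\<forall>n m. f n m \<le> poly p (n + m)" "\<forall>n m. g n m \<le> poly q (n + m)"
    using assms unfolding poly_bounded_def by blast
  then show ?thesis unfolding poly_bounded_def
    by (intro exI[of _ "p + q"]) (auto intro: add_mono)
qed

lemma poly_bounded_mult:
  assumes "poly_bounded f" "poly_bounded g"
  shows "poly_bounded (\<lambda>n m. f n m * g n m)"
proof -
  obtain p q where "\<forall>n m. f n m \<le> poly p (n + m)" "\<forall>n m. g n m \<le> poly q (n + m)"
    using assms unfolding poly_bounded_def by blast
  then show ?thesis unfolding poly_bounded_def
    by (intro exI[of _ "p * q"]) (auto intro: mult_le_mono)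
qed

lemma poly_bounded_Suc: "poly_bounded f \<Longrightarrow> poly_bounded (\<lambda>n m. Suc (f n m))"
  using poly_bounded_add[OF _ poly_bounded_const[of 1]] by simp

lemmas poly_bounded_intros = poly_bounded_const poly_bounded_fst poly_bounded_snd
  poly_bounded_Suc poly_bounded_add poly_bounded_mult

section \<open>Envy when all houses are assigned\<close>

text \<open>Positive value is demanded because an agent valuing all houses at zero never envies;
  matching it would gain nothing.\<close>

definition favourite :: "nat \<Rightarrow> (nat \<Rightarrow> nat \<Rightarrow> real) \<Rightarrow> nat \<Rightarrow> nat \<Rightarrow> bool" where
  "favourite m v i h \<longleftrightarrow> h < m \<and> 0 < v i h \<and> (\<forall>g<m. v i g \<le> v i h)"

definition happy :: "nat \<Rightarrow> nat \<Rightarrow> (nat \<Rightarrow> nat \<Rightarrow> real) \<Rightarrow> (nat \<rightharpoonup> nat) \<Rightarrow> nat set" where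
  "happy n m v A = {i. i < n \<and> (\<exists>h. A i = Some h \<and> favourite m v i h)}"

lemma card_ran:
  assumes "inj_on A (dom A)"
  shows "card (ran A) = card (dom A)"
proof -
  have "ran A = (the \<circ> A) ` dom A" by (force simp: ran_def dom_def image_iff)
  moreover have "inj_on (the \<circ> A) (dom A)"
    using assms by (auto simp: inj_on_def dom_def)
  ultimately show ?thesis by (simp only: card_image)
qed

text \<open>For \<open>m \<le> n\<close> the agents' branch of completeness applies only if
  \<open>n = m\<close>, and then an injection between sets of equal size is onto.\<close>

lemma complete_allocation_ran:
  fixes n m :: nat
  assumes "complete_allocation {..<n} {..<m} A" "m \<le> n"
  shows "ran A = {..<m}"
proof (cases "n \<le> m")
  case True
  with assms have A: "dom A = {..<n}" "ran A \<subseteq> {..<m}" "inj_on A (dom A)" "n = m"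
    unfolding complete_allocation_def allocation_def by auto
  then have "card (ran A) = m" using card_ran by fastforce
  then show ?thesis using A(2) by (intro card_subset_eq) auto
next
  case False
  with assms show ?thesis by (auto simp: complete_allocation_def)
qed

text \<open>With no house left over, somebody holds each agent's favourite, so an agent with a
  positive value is content only with a favourite of its own. The minuend does not depend on
  \<open>A\<close>: minimising envy means maximising \<open>happy\<close>.\<close>

lemma num_envy_all_assigned:
  assumes v: "house_instance {..<n} {..<m} v" and A: "allocation {..<n} {..<m} A"
    and ran: "ran A = {..<m}"
  shows "num_envy {..<n} v A = card {i. i < n \<and> (\<exists>h<m. 0 < v i h)} - card (happy n m v A)"
proof -
  let ?pos = "{i. i < n \<and> (\<exists>h<m. 0 < v i h)}"
  have "(\<exists>j<n. envies v A i j) \<longleftrightarrow> i \<in> ?pos \<and> i \<notin> happy n m v A" if i: "i < n" for i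
  proof
    assume "\<exists>j<n. envies v A i j"
    then obtain j where j: "bundle_value v i (A i) < bundle_value v i (A j)"
      by (auto simp: envies_def)
    \<comment> \<open>By non-negativity the envied bundle has positive value, so it is a house
      rather than \<open>None\<close>.\<close>
    have "0 \<le> bundle_value v i (A i)"
    proof (cases "A i")
      case (Some h)
      then have "h < m" using ran by (auto simp: ran_def)
      then show ?thesis using v i Some by (simp add: house_instance_def)
    qed simp
    with j obtain h where h: "A j = Some h" "0 < v i h" "bundle_value v i (A i) < v i h"
      by (cases "A j") auto
    then have "h < m" using ran by (auto simp: ran_def)
    with h i show "i \<in> ?pos \<and> i \<notin> happy n m v A"
      by (auto simp: happy_def favourite_def)
  next
    assume i': "i \<in> ?pos \<and> i \<notin> happy n m v A"
    then obtain g where g: "g < m" "0 < v i g" by blast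
    have "Max (v i ` {..<m}) \<in> v i ` {..<m}" using g by (intro Max_in) auto
    then obtain h where h: "h < m" "v i h = Max (v i ` {..<m})" by auto
    have best: "v i h' \<le> v i h" if "h' < m" for h' using that h(2) by simp
    have pos: "0 < v i h" using best[OF g(1)] g(2) by simp
    from h(1) ran obtain j where j: "A j = Some h" by (auto simp: ran_def set_eq_iff)
    have "j < n" using j A by (auto simp: allocation_def)
    have "bundle_value v i (A i) < v i h"
    proof (cases "A i")
      case (Some h')
      then have "h' < m" using ran by (auto simp: ran_def)
      moreover have "\<not> favourite m v i h'" using i' Some i by (auto simp: happy_def)
      ultimately have "v i h' \<noteq> v i h" using best pos by (auto simp: favourite_def)
      with best[OF \<open>h' < m\<close>] Some show ?thesis by simp
    qed (simp add: pos)
    with j \<open>j < n\<close> show "\<exists>j<n. envies v A i j" by (auto simp: envies_def)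
  qed
  then have "{i \<in> {..<n}. \<exists>j\<in>{..<n}. envies v A i j} = ?pos - happy n m v A"
    by auto
  moreover have "happy n m v A \<subseteq> ?pos" by (auto simp: happy_def favourite_def)
  ultimately show ?thesis
    unfolding num_envy_def by (simp add: card_Diff_subset finite_subset[of _ ?pos])
qed

section \<open>The auction\<close>

text \<open>Owners and the current bidder \<open>c\<close> are agents shifted by one, with 0 for nobody;
  \<open>k\<close> is the number of agents that have entered the auction.\<close>

definition auction_inv ::
    "(nat \<Rightarrow> nat \<Rightarrow> bool) \<Rightarrow> nat \<Rightarrow> nat \<Rightarrow> (nat \<Rightarrow> nat) \<Rightarrow> (nat \<Rightarrow> nat) \<Rightarrow> nat \<Rightarrow> bool" where
  "auction_inv E m k p ow c \<longleftrightarrow> c \<le> k \<and>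
     (\<forall>h<m. p h \<le> m + 2 \<and> ow h \<le> k \<and> (ow h = 0 \<longrightarrow> p h = 0)) \<and>
     (\<forall>h<m. 0 < ow h \<longrightarrow> ow h \<noteq> c \<and> E (ow h - 1) h \<and> (\<forall>g<m. ow g = ow h \<longrightarrow> g = h) \<and>
        (\<forall>g<m. E (ow h - 1) g \<longrightarrow> p h \<le> Suc (p g))) \<and>
     (\<forall>i<k. Suc i \<noteq> c \<longrightarrow> (\<forall>h<m. ow h \<noteq> Suc i) \<longrightarrow> (\<forall>h<m. E i h \<longrightarrow> m + 2 \<le> p h))"

lemma auction_inv_init: "auction_inv E m 0 (\<lambda>_. 0) (\<lambda>_. 0) 0"
  by (simp add: auction_inv_def)

text \<open>Owners are at most \<open>k\<close>, so the newcomer \<open>Suc k\<close> (agent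
  \<open>k\<close>, shifted) owns nothing. With bidder 0, the last clause already covers all
  houseless agents below \<open>k\<close>.\<close>

lemma auction_inv_enter:
  assumes "auction_inv E m k p ow 0"
  shows "auction_inv E m (Suc k) p ow (Suc k)"
proof -
  have "m + 2 \<le> p h"
    if "i < Suc k" "Suc i \<noteq> Suc k" "\<forall>h<m. ow h \<noteq> Suc i" "h < m" "E i h" for i h
  proof -
    have "i < k" using that(1,2) by simp
    then show ?thesis using assms that(3-5) unfolding auction_inv_def by blast
  qed
  moreover have "ow h \<le> Suc k \<and> ow h \<noteq> Suc k" if "h < m" for h
    using assms that unfolding auction_inv_def by (metis le_SucI not_less_eq_eq order_refl)
  ultimately show ?thesis using assms unfolding auction_inv_def by blast
qed

text \<open>Once priced out, the bidder meets the last clause of the invariant, from which it was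
  exempt while bidding.\<close>

lemma auction_inv_give_up:
  assumes "auction_inv E m k p ow c" "\<forall>h<m. E (c - 1) h \<longrightarrow> m + 2 \<le> p h"
  shows "auction_inv E m k p ow 0"
proof -
  have "m + 2 \<le> p h" if "i < k" "\<forall>h<m. ow h \<noteq> Suc i" "h < m" "E i h" for i h
  proof (cases "Suc i = c")
    case True
    then show ?thesis using assms(2) that by auto
  next
    case False
    then show ?thesis using assms(1) that unfolding auction_inv_def by blast
  qed
  then show ?thesis using assms(1) unfolding auction_inv_def by blast
qed

text \<open>Since \<open>g\<close> is a cheapest house, its raised price exceeds no adjacent price
  by more than one, as the clause on owners asks. For the other owners only right-hand sides of that
  clause grow. The evicted owner \<open>ow g\<close>, or 0 if \<open>g\<close> was free, bids
  next.\<close>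

lemma auction_inv_bid:
  assumes inv: "auction_inv E m k p ow c" and c: "0 < c"
    and g: "g < m" "E (c - 1) g" "p g < m + 2"
    and cheapest: "\<forall>h<m. E (c - 1) h \<longrightarrow> p g \<le> p h"
  shows "auction_inv E m k (p(g := Suc (p g))) (ow(g := c)) (ow g)"
proof -
  have basic: "c \<le> k" "p h \<le> m + 2" "ow h \<le> k" "ow h = 0 \<Longrightarrow> p h = 0" if "h < m" for h
    using inv that by (auto simp: auction_inv_def)
  have owner: "ow h \<noteq> c" "E (ow h - 1) h" "h' < m \<Longrightarrow> ow h' = ow h \<Longrightarrow> h' = h"
    "h' < m \<Longrightarrow> E (ow h - 1) h' \<Longrightarrow> p h \<le> Suc (p h')" if "h < m" "0 < ow h" for h h'
    using inv that unfolding auction_inv_def by blast+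
  have out: "m + 2 \<le> p h"
    if "i < k" "Suc i \<noteq> c" "\<forall>h<m. ow h \<noteq> Suc i" "h < m" "E i h" for i h
    using inv that unfolding auction_inv_def by blast
  let ?p = "p(g := Suc (p g))" and ?o = "ow(g := c)"
  have p_le: "p h \<le> ?p h" for h by simp
  have "?p h \<le> m + 2 \<and> ?o h \<le> k \<and> (?o h = 0 \<longrightarrow> ?p h = 0)" if "h < m" for h
    using basic[OF that] g c by auto
  moreover have "?o h \<noteq> ow g \<and> E (?o h - 1) h \<and> (\<forall>h'<m. ?o h' = ?o h \<longrightarrow> h' = h) \<and>
      (\<forall>h'<m. E (?o h - 1) h' \<longrightarrow> ?p h \<le> Suc (?p h'))" if h: "h < m" "0 < ?o h" for h
  proof (cases "h = g")
    case True
    have "c \<noteq> ow g" using owner(1)[of g] g c by auto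
    moreover have "ow h' \<noteq> c" if "h' < m" for h' using owner(1)[OF that] c by auto
    ultimately show ?thesis using True g cheapest by auto
  next
    case False
    then have h': "0 < ow h" using h by simp
    have "ow h \<noteq> ow g" using owner(3)[OF h(1) h', of g] g False by auto
    moreover have "p h \<le> Suc (?p h')" if "h' < m" "E (ow h - 1) h'" for h'
      using owner(4)[OF h(1) h' that] p_le[of h'] by simp
    ultimately show ?thesis using False owner[OF h(1) h'] by auto
  qed
  moreover have "m + 2 \<le> ?p h"
    if i: "i < k" "Suc i \<noteq> ow g" "\<forall>h<m. ?o h \<noteq> Suc i" "h < m" "E i h" for i h
  proof -
    have "Suc i \<noteq> c" using i(3) g(1) by (metis fun_upd_same)
    moreover have "\<forall>h<m. ow h \<noteq> Suc i" using i(2,3) by (metis fun_upd_other)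
    ultimately show ?thesis using out[of i h] i p_le[of h] by (metis order_trans)
  qed
  ultimately show ?thesis unfolding auction_inv_def using basic(3)[OF g(1)] by blast
qed

text \<open>The price raises still possible, plus one for a pending bid, so that giving up decreases
  it too.\<close>

definition potential :: "nat \<Rightarrow> (nat \<Rightarrow> nat) \<Rightarrow> nat \<Rightarrow> nat" where
  "potential m p c = (\<Sum>h<m. m + 2 - p h) + (if c = 0 then 0 else 1)"

lemma potential_le: "potential m p c \<le> m * (m + 2) + 1"
proof -
  have "(\<Sum>h<m. m + 2 - p h) \<le> (\<Sum>h<m. m + 2)" by (rule sum_mono) simp
  then show ?thesis by (simp add: potential_def)
qed

text \<open>The sum drops, and the unit for the bidder \<open>c\<close> was already counted, so it
  does not matter whether the next bidder \<open>c'\<close> is 0.\<close>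

lemma potential_bid:
  assumes "g < m" "p g < m + 2" "0 < c"
  shows "potential m (p(g := Suc (p g))) c' < potential m p c"
proof -
  have "(\<Sum>h<m. m + 2 - (p(g := Suc (p g))) h) < (\<Sum>h<m. m + 2 - p h)"
    by (rule sum_strict_mono_ex1) (use assms in auto)
  then show ?thesis using assms(3) by (simp add: potential_def)
qed

text \<open>\<open>f\<close> on \<open>D\<close> is an arbitrary matching. Each of its edges is
  charged to a cover vertex: to the house if its price exceeds the gap \<open>k\<close>, otherwise
  to the agent, who then owns a house cheaper than \<open>k\<close>.\<close>

lemma auction_maximum:
  assumes inv: "auction_inv E m n p ow 0"
    and inj: "inj_on f D" and D: "\<And>i. i \<in> D \<Longrightarrow> i < n \<and> f i < m \<and> E i (f i)"
  shows "card D \<le> card {h. h < m \<and> 0 < ow h}"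
proof -
  have owner: "\<And>h. h < m \<Longrightarrow> ow h = 0 \<Longrightarrow> p h = 0"
    "\<And>h g. h < m \<Longrightarrow> 0 < ow h \<Longrightarrow> g < m \<Longrightarrow> E (ow h - 1) g \<Longrightarrow> p h \<le> Suc (p g)"
    using inv unfolding auction_inv_def by blast+
  have out: "m + 2 \<le> p h" if "i < n" "\<forall>h<m. ow h \<noteq> Suc i" "h < m" "E i h" for i h
    using inv that unfolding auction_inv_def by blast
  \<comment> \<open>Pigeonhole: \<open>m\<close> houses cannot realise all of \<open>m + 1\<close>
    prices.\<close>
  have "\<not> {1..m + 1} \<subseteq> p ` {..<m}"
  proof
    assume "{1..m + 1} \<subseteq> p ` {..<m}"
    then have "card {1..m + 1} \<le> card (p ` {..<m})" by (intro card_mono) auto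
    also have "\<dots> \<le> m" using card_image_le[of "{..<m}" p] by simp
    finally show False by simp
  qed
  then obtain k where k: "1 \<le> k" "k \<le> m + 1" "\<And>h. h < m \<Longrightarrow> p h \<noteq> k"
    by (force simp: subset_iff image_iff)
  let ?T = "{h. h < m \<and> k < p h}" and ?C = "{h. h < m \<and> 0 < ow h \<and> p h < k}"
  have fin: "finite D" using D by (intro finite_subset[of D "{..<n}"]) auto
  have "card {i \<in> D. k < p (f i)} \<le> card ?T"
    by (rule card_inj_on_le[of f]) (use inj D in \<open>auto intro: inj_on_subset\<close>)
  moreover have "{i \<in> D. \<not> k < p (f i)} \<subseteq> (\<lambda>h. ow h - 1) ` ?C"
  proof
    fix i assume "i \<in> {i \<in> D. \<not> k < p (f i)}"
    with D k(3) have i: "i < n" "f i < m" "E i (f i)" "p (f i) < k"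
      by (auto simp: order.strict_iff_order)
    \<comment> \<open>A price below \<open>k \<le> m + 1\<close> is below the giving-up price, so
      \<open>i\<close> cannot be houseless.\<close>
    have "\<exists>h<m. ow h = Suc i" using out[OF i(1) _ i(2,3)] i(4) k(2) by auto
    then obtain h where h: "h < m" "ow h = Suc i" by blast
    \<comment> \<open>The clause on owners gives \<open>p h \<le> Suc (p (f i)) \<le> k\<close>, and
      no house costs exactly \<open>k\<close>.\<close>
    with owner(2)[of h "f i"] i k(3)[of h] have "p h < k" by auto
    with h show "i \<in> (\<lambda>h. ow h - 1) ` ?C" by force
  qed
  then have "card {i \<in> D. \<not> k < p (f i)} \<le> card ?C"
    by (intro surj_card_le) auto
  moreover have "card D = card {i \<in> D. k < p (f i)} + card {i \<in> D. \<not> k < p (f i)}"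
    using fin by (subst card_Un_disjoint[symmetric]) (auto intro: arg_cong[where f = card])
  \<comment> \<open>Unowned houses cost 0, so every house dearer than \<open>k\<close> is owned, and
    \<open>1 \<le> k\<close>.\<close>
  moreover have "{h. h < m \<and> 0 < ow h} = ?T \<union> ?C"
    using owner(1) k(1,3) by (force simp: neq_iff)
  then have "card {h. h < m \<and> 0 < ow h} = card ?T + card ?C"
    by (simp add: card_Un_disjoint disjoint_iff)
  ultimately show ?thesis by linarith
qed

section \<open>The program\<close>

text \<open>There is no multiplication, so \<open>R\<close> tabulates the row offsets \<open>i * m\<close>. As for the owners \<open>O\<close>
  and the bidder \<open>c\<close>, the cheapest house \<open>g\<close> found by a scan is shifted by one, with 0 for none;
  \<open>b\<close> is its price.\<close>

definition val_ih :: rexp where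
  "val_ih = RGet ''v'' (NPlus (NGet ''R'' (Var ''i'')) (Var ''h''))"

definition row_init :: com where
  "row_init = Seq (NStore ''R'' (Var ''i'') (Var ''r'')) (Assign ''r'' (NPlus (Var ''r'') (Var ''m'')))"

definition row_step :: com where
  "row_step = If (RLess (RGet ''top'' (Var ''i'')) val_ih) (RStore ''top'' (Var ''i'') val_ih) Skip"

definition find_tops :: com where
  "find_tops = For ''i'' ''n'' (Seq row_init (For ''h'' ''m'' row_step))"

text \<open>Starting \<open>b\<close> at \<open>m + 2\<close> makes the strict price test skip
  houses at the giving-up price, so \<open>g\<close> being 0 after the scan means that the bidder is
  priced out.\<close>

definition scan_init :: com where
  "scan_init = Seq (Assign ''i'' (NMinus (Var ''c'') (NConst 1)))
     (Seq (Assign ''b'' (NPlus (Var ''m'') (NConst 2))) (Assign ''g'' (NConst 0)))"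

definition scan_step :: com where
  "scan_step = If (And (NLess (NGet ''p'' (Var ''h'')) (Var ''b''))
       (And (RLess (RConst 0) val_ih) (Not (RLess val_ih (RGet ''top'' (Var ''i''))))))
     (Seq (Assign ''b'' (NGet ''p'' (Var ''h''))) (Assign ''g'' (NPlus (Var ''h'') (NConst 1)))) Skip"

text \<open>The old owner is saved in \<open>o\<close> before being overwritten. If the house was
  free, \<open>o\<close> is 0 and the new \<open>c\<close> ends the bidding loop.\<close>

definition bid :: com where
  "bid = If (NLess (NConst 0) (Var ''g''))
     (Seq (Assign ''o'' (NGet ''O'' (NMinus (Var ''g'') (NConst 1))))
     (Seq (NStore ''O'' (NMinus (Var ''g'') (NConst 1)) (Var ''c''))
     (Seq (NStore ''p'' (NMinus (Var ''g'') (NConst 1)) (NPlus (Var ''b'') (NConst 1)))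
          (Assign ''c'' (Var ''o'')))))
     (Assign ''c'' (NConst 0))"

definition enter :: com where
  "enter = Assign ''c'' (NPlus (Var ''k'') (NConst 1))"

text \<open>Agents enter one by one; the inner loop follows the chain of evictions until a free
  house is taken or the current bidder gives up.\<close>

definition auction :: com where
  "auction = For ''k'' ''n'' (Seq enter (While (NLess (NConst 0) (Var ''c''))
     (Seq (Seq scan_init (For ''h'' ''m'' scan_step)) bid)))"

definition collect_step :: com where
  "collect_step = If (NLess (NConst 0) (NGet ''O'' (Var ''h'')))
     (NStore ''A'' (NMinus (NGet ''O'' (Var ''h'')) (NConst 1)) (NPlus (Var ''h'') (NConst 1))) Skip"

definition collect :: com where
  "collect = For ''h'' ''m'' collect_step"

definition fill_step :: com where
  "fill_step = If (And (Not (NLess (NConst 0) (NGet ''A'' (Var ''i''))))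
       (Not (NLess (NConst 0) (NGet ''O'' (Var ''h'')))))
     (Seq (NStore ''A'' (Var ''i'') (NPlus (Var ''h'') (NConst 1)))
          (NStore ''O'' (Var ''h'') (NPlus (Var ''i'') (NConst 1)))) Skip"

definition fill :: com where
  "fill = For ''i'' ''n'' (For ''h'' ''m'' fill_step)"

definition assign_houses :: com where
  "assign_houses = Seq find_tops (Seq auction (Seq collect fill))"

section \<open>Verification of the table of favourites\<close>

definition sizes :: "nat \<Rightarrow> nat \<Rightarrow> state \<Rightarrow> bool" where
  "sizes n m s \<longleftrightarrow> nmem s ''n'' 0 = n \<and> nmem s ''m'' 0 = m"

text \<open>The maximum of 0 and the first \<open>j\<close> values; 0 is the content of fresh
  memory.\<close>

definition running_max :: "nat \<Rightarrow> (nat \<Rightarrow> real) \<Rightarrow> real \<Rightarrow> bool" where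
  "running_max j w x \<longleftrightarrow> (\<forall>h<j. w h \<le> x) \<and> 0 \<le> x \<and> (x = 0 \<or> (\<exists>h<j. w h = x))"

definition tops_inv :: "nat \<Rightarrow> nat \<Rightarrow> (nat \<Rightarrow> nat \<Rightarrow> real) \<Rightarrow> nat \<Rightarrow> state \<Rightarrow> bool" where
  "tops_inv n m v k s \<longleftrightarrow> sizes n m s \<and>
     (\<forall>i<n. \<forall>h<m. rmem s ''v'' (i * m + h) = v i h) \<and>
     nmem s ''O'' = (\<lambda>_. 0) \<and> nmem s ''p'' = (\<lambda>_. 0) \<and> nmem s ''A'' = (\<lambda>_. 0) \<and>
     nmem s ''i'' 0 = k \<and>
     (\<forall>i<k. nmem s ''R'' i = i * m \<and> running_max m (v i) (rmem s ''top'' i))"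

definition ready :: "nat \<Rightarrow> nat \<Rightarrow> (nat \<Rightarrow> nat \<Rightarrow> real) \<Rightarrow> state \<Rightarrow> bool" where
  "ready n m v s \<longleftrightarrow> sizes n m s \<and> nmem s ''A'' = (\<lambda>_. 0) \<and>
     (\<forall>i<n. \<forall>h<m. favourite m v i h \<longleftrightarrow>
        0 < rmem s ''v'' (nmem s ''R'' i + h) \<and>
        \<not> rmem s ''v'' (nmem s ''R'' i + h) < rmem s ''top'' i)"

lemma favourite_iff_running_max:
  assumes "running_max m (v i) x" "h < m"
  shows "favourite m v i h \<longleftrightarrow> 0 < v i h \<and> \<not> v i h < x"
  using assms unfolding favourite_def running_max_def by (meson leD leI order_trans)

lemma hoare_find_tops:
  "hoare (3 + Suc n * (max_cost row_init + (3 + Suc m * (max_cost row_step + 12)) + 12))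
     (\<lambda>s. s = input_state n m v) find_tops
     (\<lambda>s. ready n m v s \<and> nmem s ''O'' = (\<lambda>_. 0) \<and> nmem s ''p'' = (\<lambda>_. 0))"
  unfolding find_tops_def
\<comment> \<open>Rows not yet processed must still hold 0 in \<open>top\<close>, the start of their
  running maximum.\<close>
proof (rule hoare_For[where I = "\<lambda>k s. tops_inv n m v k s \<and> nmem s ''r'' 0 = k * m \<and>
    (\<forall>i\<ge>k. rmem s ''top'' i = 0)"])
  fix s assume "s = input_state n m v"
  moreover have "i * m + h < n * m" if "i < n" "h < m" for i h
  proof -
    have "i * m + h < Suc i * m" using that by simp
    also have "\<dots> \<le> n * m" using that by (intro mult_le_mono1) simp
    finally show ?thesis .
  qed
  ultimately show "tops_inv n m v 0 (nstore ''i'' 0 0 s) \<and> nmem (nstore ''i'' 0 0 s) ''r'' 0 = 0 * m \<and>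
      (\<forall>i\<ge>0. rmem (nstore ''i'' 0 0 s) ''top'' i = 0)"
    by (auto simp: tops_inv_def sizes_def input_state_def fun_eq_iff)
next
  fix k s assume "tops_inv n m v k s \<and> nmem s ''r'' 0 = k * m \<and> (\<forall>i\<ge>k. rmem s ''top'' i = 0)"
  then show "nmem s ''i'' 0 = k \<and> nmem s ''n'' 0 = n" by (simp add: tops_inv_def sizes_def)
next
  fix k assume k: "k < n"
  let ?I = "\<lambda>j s. tops_inv n m v k s \<and> nmem s ''r'' 0 = Suc k * m \<and> nmem s ''R'' k = k * m \<and>
    running_max j (v k) (rmem s ''top'' k) \<and> (\<forall>i>k. rmem s ''top'' i = 0)"
  show "hoare (max_cost row_init + (3 + Suc m * (max_cost row_step + 12)))
      (\<lambda>s. tops_inv n m v k s \<and> nmem s ''r'' 0 = k * m \<and> (\<forall>i\<ge>k. rmem s ''top'' i = 0))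
      (Seq row_init (For ''h'' ''m'' row_step))
      (\<lambda>s. nmem s ''i'' 0 = k \<and> (tops_inv n m v (Suc k) (nstore ''i'' 0 (Suc k) s) \<and>
         nmem (nstore ''i'' 0 (Suc k) s) ''r'' 0 = Suc k * m \<and>
         (\<forall>i\<ge>Suc k. rmem (nstore ''i'' 0 (Suc k) s) ''top'' i = 0)))"
  proof (rule hoare_Seq[where R = "?I 0"])
    show "hoare (max_cost row_init)
      (\<lambda>s. tops_inv n m v k s \<and> nmem s ''r'' 0 = k * m \<and> (\<forall>i\<ge>k. rmem s ''top'' i = 0))
      row_init (?I 0)"
      by (rule hoare_loop_free)
        (auto simp: row_init_def tops_inv_def sizes_def running_max_def)
  next
    show "hoare (3 + Suc m * (max_cost row_step + 12)) (?I 0) (For ''h'' ''m'' row_step)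
      (\<lambda>s. nmem s ''i'' 0 = k \<and> (tops_inv n m v (Suc k) (nstore ''i'' 0 (Suc k) s) \<and>
         nmem (nstore ''i'' 0 (Suc k) s) ''r'' 0 = Suc k * m \<and>
         (\<forall>i\<ge>Suc k. rmem (nstore ''i'' 0 (Suc k) s) ''top'' i = 0)))"
    proof (rule hoare_For[where I = "\<lambda>j s. ?I j s \<and> nmem s ''h'' 0 = j"])
      fix j assume j: "j < m"
      show "hoare (max_cost row_step) (\<lambda>s. ?I j s \<and> nmem s ''h'' 0 = j) row_step
        (\<lambda>s. nmem s ''h'' 0 = j \<and> (?I (Suc j) (nstore ''h'' 0 (Suc j) s) \<and>
           nmem (nstore ''h'' 0 (Suc j) s) ''h'' 0 = Suc j))"
      proof (rule hoare_loop_free)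
        fix s assume s: "?I j s \<and> nmem s ''h'' 0 = j"
        then have v: "rval val_ih s = v k j"
          using k j by (simp add: val_ih_def tops_inv_def)
        have "running_max (Suc j) (v k) (if rmem s ''top'' k < v k j then v k j else rmem s ''top'' k)"
          using s by (auto simp: running_max_def less_Suc_eq)
        with s v show "nmem (final_state row_step s) ''h'' 0 = j \<and>
           (?I (Suc j) (nstore ''h'' 0 (Suc j) (final_state row_step s)) \<and>
           nmem (nstore ''h'' 0 (Suc j) (final_state row_step s)) ''h'' 0 = Suc j)"
          by (auto simp: row_step_def tops_inv_def sizes_def split: if_splits)
      qed (simp add: row_step_def)
    qed (auto simp: tops_inv_def sizes_def less_Suc_eq)
  qed
next
  fix s assume s: "tops_inv n m v n s \<and> nmem s ''r'' 0 = n * m \<and> (\<forall>i\<ge>n. rmem s ''top'' i = 0)"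
  then have "favourite m v i h \<longleftrightarrow> 0 < rmem s ''v'' (nmem s ''R'' i + h) \<and>
      \<not> rmem s ''v'' (nmem s ''R'' i + h) < rmem s ''top'' i" if "i < n" "h < m" for i h
    using favourite_iff_running_max[of m v i "rmem s ''top'' i" h] that by (simp add: tops_inv_def)
  with s show "ready n m v s \<and> nmem s ''O'' = (\<lambda>_. 0) \<and> nmem s ''p'' = (\<lambda>_. 0)"
    by (simp add: ready_def tops_inv_def)
qed

section \<open>Verification of the auction\<close>

definition scan_inv ::
    "(nat \<Rightarrow> nat \<Rightarrow> bool) \<Rightarrow> nat \<Rightarrow> nat \<Rightarrow> (nat \<Rightarrow> nat) \<Rightarrow> nat \<Rightarrow> nat \<Rightarrow> nat \<Rightarrow> bool" where
  "scan_inv E m i p j b g \<longleftrightarrow> (\<forall>h<j. E i h \<longrightarrow> b \<le> p h) \<and>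
     (g = 0 \<and> b = m + 2 \<or> (\<exists>h<j. g = Suc h \<and> E i h \<and> b = p h \<and> b < m + 2))"

text \<open>In the invariant, \<open>b\<close> is the minimum of \<open>m + 2\<close> and the
  adjacent prices among the first \<open>j\<close> houses. A price below \<open>b\<close> is the
  minimum over one house more and stays below \<open>m + 2\<close>.\<close>

lemma scan_inv_hit:
  assumes "scan_inv E m i p j b g" "p j < b" "E i j"
  shows "scan_inv E m i p (Suc j) (p j) (Suc j)"
proof -
  have "b \<le> m + 2" using assms(1) by (auto simp: scan_inv_def)
  moreover have "p j \<le> p h" if "h < Suc j" "E i h" for h
    using assms that by (cases "h = j") (force simp: scan_inv_def less_Suc_eq)+
  ultimately show ?thesis using assms(2,3) unfolding scan_inv_def by auto
qed

lemma scan_inv_miss: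
  assumes "scan_inv E m i p j b g" "\<not> (p j < b \<and> E i j)"
  shows "scan_inv E m i p (Suc j) b g"
  using assms unfolding scan_inv_def by (metis less_Suc_eq not_less)

definition bidding :: "nat \<Rightarrow> nat \<Rightarrow> (nat \<Rightarrow> nat \<Rightarrow> real) \<Rightarrow> nat \<Rightarrow> state \<Rightarrow> bool" where
  "bidding n m v k s \<longleftrightarrow> ready n m v s \<and> nmem s ''k'' 0 = k \<and>
     auction_inv (favourite m v) m (Suc k) (nmem s ''p'') (nmem s ''O'') (nmem s ''c'' 0)"

abbreviation state_potential :: "nat \<Rightarrow> state \<Rightarrow> nat" where
  "state_potential m s \<equiv> potential m (nmem s ''p'') (nmem s ''c'' 0)"

text \<open>A scan leaves prices and bidder alone; the value \<open>l\<close> of the potential is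
  carried along for comparison after the bid.\<close>

lemma hoare_scan:
  assumes k: "k < n"
  shows "hoare (max_cost scan_init + (3 + Suc m * (max_cost scan_step + 12)))
    (\<lambda>s. bidding n m v k s \<and> 0 < nmem s ''c'' 0 \<and> state_potential m s = l)
    (Seq scan_init (For ''h'' ''m'' scan_step))
    (\<lambda>s. bidding n m v k s \<and> 0 < nmem s ''c'' 0 \<and> state_potential m s = l \<and>
       scan_inv (favourite m v) m (nmem s ''c'' 0 - 1) (nmem s ''p'') m (nmem s ''b'' 0) (nmem s ''g'' 0))"
proof (rule hoare_Seq)
  let ?I = "\<lambda>j s. bidding n m v k s \<and> 0 < nmem s ''c'' 0 \<and> state_potential m s = l \<and>
    nmem s ''i'' 0 = nmem s ''c'' 0 - 1 \<and>
    scan_inv (favourite m v) m (nmem s ''c'' 0 - 1) (nmem s ''p'') j (nmem s ''b'' 0) (nmem s ''g'' 0)"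
  show "hoare (max_cost scan_init)
      (\<lambda>s. bidding n m v k s \<and> 0 < nmem s ''c'' 0 \<and> state_potential m s = l) scan_init (?I 0)"
    by (rule hoare_loop_free)
      (auto simp: scan_init_def bidding_def ready_def sizes_def scan_inv_def)
  show "hoare (3 + Suc m * (max_cost scan_step + 12)) (?I 0) (For ''h'' ''m'' scan_step)
    (\<lambda>s. bidding n m v k s \<and> 0 < nmem s ''c'' 0 \<and> state_potential m s = l \<and>
       scan_inv (favourite m v) m (nmem s ''c'' 0 - 1) (nmem s ''p'') m (nmem s ''b'' 0) (nmem s ''g'' 0))"
  proof (rule hoare_For[where I = "\<lambda>j s. ?I j s \<and> nmem s ''h'' 0 = j"])
    fix j assume j: "j < m"
    show "hoare (max_cost scan_step) (\<lambda>s. ?I j s \<and> nmem s ''h'' 0 = j) scan_step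
      (\<lambda>s. nmem s ''h'' 0 = j \<and> (?I (Suc j) (nstore ''h'' 0 (Suc j) s) \<and>
         nmem (nstore ''h'' 0 (Suc j) s) ''h'' 0 = Suc j))"
    proof (rule hoare_loop_free)
      fix s assume s: "?I j s \<and> nmem s ''h'' 0 = j"
      let ?i = "nmem s ''c'' 0 - 1" and ?p = "nmem s ''p''" and ?b = "nmem s ''b'' 0"
      have "?i < n" using s k by (auto simp: bidding_def auction_inv_def)
      then have E: "0 < rval val_ih s \<and> \<not> rval val_ih s < rmem s ''top'' ?i \<longleftrightarrow> favourite m v ?i j"
        using s j by (simp add: val_ih_def bidding_def ready_def)
      have "scan_inv (favourite m v) m ?i ?p (Suc j) (?p j) (Suc j)"
        if "?p j < ?b" "favourite m v ?i j"
        using s that by (blast intro: scan_inv_hit)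
      moreover have "scan_inv (favourite m v) m ?i ?p (Suc j) ?b (nmem s ''g'' 0)"
        if "\<not> (?p j < ?b \<and> favourite m v ?i j)"
        using s that by (blast intro: scan_inv_miss)
      ultimately show "nmem (final_state scan_step s) ''h'' 0 = j \<and>
          (?I (Suc j) (nstore ''h'' 0 (Suc j) (final_state scan_step s)) \<and>
          nmem (nstore ''h'' 0 (Suc j) (final_state scan_step s)) ''h'' 0 = Suc j)"
        using s E by (auto simp: scan_step_def bidding_def ready_def sizes_def)
    qed (simp add: scan_step_def)
  qed (auto simp: bidding_def ready_def sizes_def)
qed

lemma hoare_bid:
  "hoare (max_cost bid)
    (\<lambda>s. bidding n m v k s \<and> 0 < nmem s ''c'' 0 \<and> state_potential m s = l \<and>
       scan_inv (favourite m v) m (nmem s ''c'' 0 - 1) (nmem s ''p'') m (nmem s ''b'' 0) (nmem s ''g'' 0))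
    bid (\<lambda>s. bidding n m v k s \<and> state_potential m s < l)"
proof (rule hoare_loop_free)
  fix s :: state
  let ?c = "nmem s ''c'' 0" and ?p = "nmem s ''p''" and ?b = "nmem s ''b'' 0"
    and ?g = "nmem s ''g'' 0" and ?o = "nmem s ''O''"
  assume s: "bidding n m v k s \<and> 0 < ?c \<and> state_potential m s = l \<and>
    scan_inv (favourite m v) m (?c - 1) ?p m ?b ?g"
  then have inv: "auction_inv (favourite m v) m (Suc k) ?p ?o ?c" by (simp add: bidding_def)
  show "bidding n m v k (final_state bid s) \<and> state_potential m (final_state bid s) < l"
  proof (cases "?g = 0")
    case True
    with s have "\<forall>h<m. favourite m v (?c - 1) h \<longrightarrow> m + 2 \<le> ?p h" by (auto simp: scan_inv_def)
    with inv have "auction_inv (favourite m v) m (Suc k) ?p ?o 0" by (rule auction_inv_give_up)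
    moreover have "potential m ?p 0 < potential m ?p ?c" using s by (simp add: potential_def)
    ultimately show ?thesis using s True
      by (auto simp: bid_def bidding_def ready_def sizes_def)
  next
    case False
    with s obtain g where g: "g < m" "?g = Suc g" "favourite m v (?c - 1) g" "?b = ?p g" "?p g < m + 2"
      by (auto simp: scan_inv_def)
    have "auction_inv (favourite m v) m (Suc k) (?p(g := Suc (?p g))) (?o(g := ?c)) (?o g)"
      by (rule auction_inv_bid[OF inv]) (use s g in \<open>auto simp: scan_inv_def\<close>)
    moreover have "potential m (?p(g := Suc (?p g))) (?o g) < potential m ?p ?c"
      by (rule potential_bid) (use s g in auto)
    ultimately show ?thesis using s g
      by (auto simp: bid_def bidding_def ready_def sizes_def)
  qed
qed (simp add: bid_def)

text \<open>The bidding loop of each entering agent is bounded separately by the largest potential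
  \<open>m * (m + 2) + 1\<close>, without amortising over the agents.\<close>

lemma hoare_auction:
  "hoare (3 + Suc n * (max_cost enter + Suc (m * (m + 2) + 1) *
       (1 + bcost (NLess (NConst 0) (Var ''c'')) +
         (max_cost scan_init + (3 + Suc m * (max_cost scan_step + 12)) + max_cost bid)) + 12))
    (\<lambda>s. ready n m v s \<and> nmem s ''O'' = (\<lambda>_. 0) \<and> nmem s ''p'' = (\<lambda>_. 0)) auction
    (\<lambda>s. sizes n m s \<and> nmem s ''A'' = (\<lambda>_. 0) \<and>
      auction_inv (favourite m v) m n (nmem s ''p'') (nmem s ''O'') 0)"
  unfolding auction_def
proof (rule hoare_For[where I = "\<lambda>k s. ready n m v s \<and> nmem s ''k'' 0 = k \<and>
    auction_inv (favourite m v) m k (nmem s ''p'') (nmem s ''O'') 0"])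
  fix k assume k: "k < n"
  let ?w = "NLess (NConst 0) (Var ''c'')"
  let ?T = "max_cost scan_init + (3 + Suc m * (max_cost scan_step + 12)) + max_cost bid"
  show "hoare (max_cost enter + Suc (m * (m + 2) + 1) * (1 + bcost ?w + ?T))
    (\<lambda>s. ready n m v s \<and> nmem s ''k'' 0 = k \<and>
      auction_inv (favourite m v) m k (nmem s ''p'') (nmem s ''O'') 0)
    (Seq enter (While ?w (Seq (Seq scan_init (For ''h'' ''m'' scan_step)) bid)))
    (\<lambda>s. nmem s ''k'' 0 = k \<and> (ready n m v (nstore ''k'' 0 (Suc k) s) \<and>
      nmem (nstore ''k'' 0 (Suc k) s) ''k'' 0 = Suc k \<and>
      auction_inv (favourite m v) m (Suc k) (nmem (nstore ''k'' 0 (Suc k) s) ''p'')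
        (nmem (nstore ''k'' 0 (Suc k) s) ''O'') 0))"
  proof (rule hoare_Seq[where R = "bidding n m v k"])
    show "hoare (max_cost enter) (\<lambda>s. ready n m v s \<and> nmem s ''k'' 0 = k \<and>
      auction_inv (favourite m v) m k (nmem s ''p'') (nmem s ''O'') 0) enter (bidding n m v k)"
      by (rule hoare_loop_free)
        (auto simp: enter_def bidding_def ready_def sizes_def auction_inv_enter)
  next
    \<comment> \<open>The loop ends with bidder 0, which turns \<open>bidding\<close> for
      \<open>k\<close> into the outer invariant for \<open>Suc k\<close>.\<close>
    have "hoare (Suc (m * (m + 2) + 1) * (1 + bcost ?w + ?T)) (bidding n m v k)
      (While ?w (Seq (Seq scan_init (For ''h'' ''m'' scan_step)) bid))
      (\<lambda>s. bidding n m v k s \<and> \<not> bval ?w s)"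
    proof (rule hoare_While[where \<mu> = "state_potential m"])
      fix l
      show "hoare ?T (\<lambda>s. bidding n m v k s \<and> bval ?w s \<and> state_potential m s = l)
        (Seq (Seq scan_init (For ''h'' ''m'' scan_step)) bid)
        (\<lambda>s. bidding n m v k s \<and> state_potential m s < l)"
        by (rule hoare_conseq[OF hoare_Seq[OF hoare_scan[OF k] hoare_bid]]) auto
    qed (rule potential_le)
    then show "hoare (Suc (m * (m + 2) + 1) * (1 + bcost ?w + ?T)) (bidding n m v k)
      (While ?w (Seq (Seq scan_init (For ''h'' ''m'' scan_step)) bid))
      (\<lambda>s. nmem s ''k'' 0 = k \<and> (ready n m v (nstore ''k'' 0 (Suc k) s) \<and>
      nmem (nstore ''k'' 0 (Suc k) s) ''k'' 0 = Suc k \<and>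
      auction_inv (favourite m v) m (Suc k) (nmem (nstore ''k'' 0 (Suc k) s) ''p'')
        (nmem (nstore ''k'' 0 (Suc k) s) ''O'') 0))"
      by (rule hoare_conseq) (auto simp: bidding_def ready_def sizes_def)
  qed
qed (auto simp: ready_def sizes_def auction_inv_init)

section \<open>From owners to a complete allocation\<close>

definition partial_inverse :: "nat \<Rightarrow> (nat \<Rightarrow> nat) \<Rightarrow> (nat \<Rightarrow> nat) \<Rightarrow> bool" where
  "partial_inverse j ow a \<longleftrightarrow> (\<forall>i h. a i = Suc h \<longleftrightarrow> h < j \<and> ow h = Suc i)"

text \<open>As an equivalence, \<open>partial_inverse\<close> also excludes stray entries of
  \<open>A\<close> and two houses with one owner. The owners are named \<open>ow\<close> because
  filling will modify \<open>O\<close>.\<close>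

lemma hoare_collect:
  "hoare (3 + Suc m * (max_cost collect_step + 12))
    (\<lambda>s. sizes n m s \<and> nmem s ''A'' = (\<lambda>_. 0) \<and>
      auction_inv (favourite m v) m n (nmem s ''p'') (nmem s ''O'') 0)
    collect
    (\<lambda>s. \<exists>ow. \<exists>p. sizes n m s \<and> nmem s ''O'' = ow \<and> partial_inverse m ow (nmem s ''A'') \<and>
      auction_inv (favourite m v) m n p ow 0)"
  unfolding collect_def
proof (rule hoare_For[where I = "\<lambda>j s. sizes n m s \<and> nmem s ''h'' 0 = j \<and>
    partial_inverse j (nmem s ''O'') (nmem s ''A'') \<and>
    auction_inv (favourite m v) m n (nmem s ''p'') (nmem s ''O'') 0"])
  fix j assume j: "j < m"
  show "hoare (max_cost collect_step)
    (\<lambda>s. sizes n m s \<and> nmem s ''h'' 0 = j \<and> partial_inverse j (nmem s ''O'') (nmem s ''A'') \<and>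
      auction_inv (favourite m v) m n (nmem s ''p'') (nmem s ''O'') 0) collect_step
    (\<lambda>s. nmem s ''h'' 0 = j \<and> (sizes n m (nstore ''h'' 0 (Suc j) s) \<and>
      nmem (nstore ''h'' 0 (Suc j) s) ''h'' 0 = Suc j \<and>
      partial_inverse (Suc j) (nmem (nstore ''h'' 0 (Suc j) s) ''O'')
        (nmem (nstore ''h'' 0 (Suc j) s) ''A'') \<and>
      auction_inv (favourite m v) m n (nmem (nstore ''h'' 0 (Suc j) s) ''p'')
        (nmem (nstore ''h'' 0 (Suc j) s) ''O'') 0))"
  proof (rule hoare_loop_free)
    fix s :: state
    let ?o = "nmem s ''O''" and ?a = "nmem s ''A''"
    assume s: "sizes n m s \<and> nmem s ''h'' 0 = j \<and> partial_inverse j ?o ?a \<and>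
      auction_inv (favourite m v) m n (nmem s ''p'') ?o 0"
    then have inv: "\<And>i h. ?a i = Suc h \<longleftrightarrow> h < j \<and> ?o h = Suc i"
      and inj: "\<And>g. 0 < ?o j \<Longrightarrow> g < m \<Longrightarrow> ?o g = ?o j \<Longrightarrow> g = j"
      using j unfolding partial_inverse_def auction_inv_def by blast+
    \<comment> \<open>No earlier house shares the owner of \<open>j\<close>, so the cell written was
      still 0.\<close>
    have "partial_inverse (Suc j) ?o (?a(?o j - 1 := Suc j))" if pos: "0 < ?o j"
      unfolding partial_inverse_def
    proof (intro allI)
      fix i h
      show "(?a(?o j - 1 := Suc j)) i = Suc h \<longleftrightarrow> h < Suc j \<and> ?o h = Suc i"
      proof (cases "i = ?o j - 1")
        case True
        then have "?o j = Suc i" using pos by simp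
        then show ?thesis using True inj[OF pos, of h] j by auto
      next
        case False
        then have "?o j \<noteq> Suc i" by auto
        then show ?thesis using False inv by (auto simp: less_Suc_eq)
      qed
    qed
    moreover have "partial_inverse (Suc j) ?o ?a" if "?o j = 0"
      using inv that by (auto simp: partial_inverse_def less_Suc_eq)
    ultimately show "nmem (final_state collect_step s) ''h'' 0 = j \<and>
      (sizes n m (nstore ''h'' 0 (Suc j) (final_state collect_step s)) \<and>
      nmem (nstore ''h'' 0 (Suc j) (final_state collect_step s)) ''h'' 0 = Suc j \<and>
      partial_inverse (Suc j) (nmem (nstore ''h'' 0 (Suc j) (final_state collect_step s)) ''O'')
        (nmem (nstore ''h'' 0 (Suc j) (final_state collect_step s)) ''A'') \<and>
      auction_inv (favourite m v) m n (nmem (nstore ''h'' 0 (Suc j) (final_state collect_step s)) ''p'')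
        (nmem (nstore ''h'' 0 (Suc j) (final_state collect_step s)) ''O'') 0)"
      using s by (auto simp: collect_step_def sizes_def)
  qed (simp add: collect_step_def)
qed (auto simp: sizes_def partial_inverse_def)

text \<open>\<open>ow\<close> stands for the owners at the end of the auction, who keep their
  houses. The last clause is greedy maximality: no processed agent and house are both free.\<close>

definition fill_inv :: "nat \<Rightarrow> nat \<Rightarrow> (nat \<Rightarrow> nat) \<Rightarrow> nat \<Rightarrow> state \<Rightarrow> bool" where
  "fill_inv n m ow k s \<longleftrightarrow> sizes n m s \<and> partial_inverse m (nmem s ''O'') (nmem s ''A'') \<and>
     (\<forall>h<m. nmem s ''O'' h \<le> n \<and> (0 < ow h \<longrightarrow> nmem s ''O'' h = ow h)) \<and>
     (\<forall>i<k. \<forall>h<m. 0 < nmem s ''A'' i \<or> 0 < nmem s ''O'' h)"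

text \<open>Entries of \<open>A\<close> and \<open>O\<close> only change from 0 to positive, so a
  pair that is not both free stays so, and one pass suffices.\<close>

lemma hoare_fill:
  "hoare (3 + Suc n * (3 + Suc m * (max_cost fill_step + 12) + 12))
    (fill_inv n m ow 0) fill (fill_inv n m ow n)"
  unfolding fill_def
proof (rule hoare_For[where I = "\<lambda>k s. fill_inv n m ow k s \<and> nmem s ''i'' 0 = k"])
  fix k assume k: "k < n"
  let ?I = "\<lambda>j s. fill_inv n m ow k s \<and> nmem s ''i'' 0 = k \<and> nmem s ''h'' 0 = j \<and>
    (\<forall>h<j. 0 < nmem s ''A'' k \<or> 0 < nmem s ''O'' h)"
  show "hoare (3 + Suc m * (max_cost fill_step + 12)) (\<lambda>s. fill_inv n m ow k s \<and> nmem s ''i'' 0 = k)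
    (For ''h'' ''m'' fill_step)
    (\<lambda>s. nmem s ''i'' 0 = k \<and> (fill_inv n m ow (Suc k) (nstore ''i'' 0 (Suc k) s) \<and>
      nmem (nstore ''i'' 0 (Suc k) s) ''i'' 0 = Suc k))"
  proof (rule hoare_For[where I = ?I])
    fix j assume j: "j < m"
    show "hoare (max_cost fill_step) (?I j) fill_step
      (\<lambda>s. nmem s ''h'' 0 = j \<and> ?I (Suc j) (nstore ''h'' 0 (Suc j) s))"
    proof (rule hoare_loop_free)
      fix s :: state
      let ?o = "nmem s ''O''" and ?a = "nmem s ''A''"
      assume s: "?I j s"
      then have inv: "\<And>i h. ?a i = Suc h \<longleftrightarrow> h < m \<and> ?o h = Suc i"
        by (simp add: fill_inv_def partial_inverse_def)
      have "partial_inverse m (?o(j := Suc k)) (?a(k := Suc j))" if "?a k = 0" "?o j = 0"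
        using inv that j unfolding partial_inverse_def
        by (metis Suc_inject fun_upd_apply nat.distinct(1))
      then show "nmem (final_state fill_step s) ''h'' 0 = j \<and>
          ?I (Suc j) (nstore ''h'' 0 (Suc j) (final_state fill_step s))"
        using s j k by (auto simp: fill_step_def fill_inv_def sizes_def less_Suc_eq)
    qed (simp add: fill_step_def)
  qed (auto simp: fill_inv_def sizes_def less_Suc_eq)
qed (auto simp: fill_inv_def sizes_def)

section \<open>Optimality of the output\<close>

text \<open>A house left over would mean, by maximality, that all agents are served, which takes
  \<open>n \<ge> m\<close> houses out of fewer than \<open>m\<close>. Owners from the auction keep
  their favourites, which bounds \<open>happy\<close> from below.\<close>

lemma fill_inv_output:
  assumes inv: "fill_inv n m ow n s" and mn: "m \<le> n"
    and ow: "\<And>h. h < m \<Longrightarrow> 0 < ow h \<Longrightarrow> favourite m v (ow h - 1) h \<and> (\<forall>g<m. ow g = ow h \<longrightarrow> g = h)"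
  shows "complete_allocation {..<n} {..<m} (output_allocation n s)"
    and "card {h. h < m \<and> 0 < ow h} \<le> card (happy n m v (output_allocation n s))"
proof -
  let ?A = "output_allocation n s" and ?o = "nmem s ''O''" and ?a = "nmem s ''A''"
  have inverse: "\<And>i h. ?a i = Suc h \<longleftrightarrow> h < m \<and> ?o h = Suc i"
    and le: "\<And>h. h < m \<Longrightarrow> ?o h \<le> n" and ext: "\<And>h. h < m \<Longrightarrow> 0 < ow h \<Longrightarrow> ?o h = ow h"
    and full: "\<And>i h. i < n \<Longrightarrow> h < m \<Longrightarrow> 0 < ?a i \<or> 0 < ?o h"
    using inv by (auto simp: fill_inv_def partial_inverse_def)
  have A: "?A i = Some h \<longleftrightarrow> h < m \<and> ?o h = Suc i" for i h
    using inverse[of i h] le[of h] by (auto simp: output_allocation_def split: nat.split)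
  have dom: "dom ?A \<subseteq> {..<n}" by (auto simp: output_allocation_def split: if_splits)
  have ran: "ran ?A \<subseteq> {..<m}" by (auto simp: ran_def A)
  have "inj_on ?A (dom ?A)"
    unfolding inj_on_def
  proof (intro ballI impI)
    fix i i' assume "i \<in> dom ?A" "?A i = ?A i'"
    then obtain h where "?A i = Some h" "?A i' = Some h" by (metis domD)
    then show "i = i'" by (simp add: A)
  qed
  with dom ran have alloc: "allocation {..<n} {..<m} ?A" by (simp add: allocation_def)
  note card = card_ran[OF \<open>inj_on ?A (dom ?A)\<close>]
  have "{..<m} \<subseteq> ran ?A"
  proof (rule ccontr)
    assume "\<not> {..<m} \<subseteq> ran ?A"
    then obtain h where h: "h < m" "h \<notin> ran ?A" by auto
    then have "?o h = 0" by (cases "?o h") (auto simp: ran_def A)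
    have "?A i \<noteq> None" if "i < n" for i
      using full[OF that h(1)] \<open>?o h = 0\<close> that by (auto simp: output_allocation_def split: nat.split)
    then have "dom ?A = {..<n}" using dom by auto
    moreover have "card (ran ?A) < card {..<m}" using ran h by (intro psubset_card_mono) auto
    ultimately show False using card mn by simp
  qed
  with ran have all: "ran ?A = {..<m}" by simp
  \<comment> \<open>The agents' branch of completeness: here \<open>n = m\<close>, so using all
    houses serves all agents.\<close>
  have "dom ?A = {..<n}" if "n \<le> m"
    using dom card all mn that by (intro card_subset_eq) auto
  with alloc all show "complete_allocation {..<n} {..<m} ?A"
    by (simp add: complete_allocation_def)
  show "card {h. h < m \<and> 0 < ow h} \<le> card (happy n m v ?A)"
  proof (rule card_inj_on_le)
    show "inj_on (\<lambda>h. ow h - 1) {h. h < m \<and> 0 < ow h}"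
      by (rule inj_onI) (use ow in \<open>auto simp: gr0_conv_Suc\<close>)
    show "(\<lambda>h. ow h - 1) ` {h. h < m \<and> 0 < ow h} \<subseteq> happy n m v ?A"
    proof clarify
      fix h assume h: "h < m" "0 < ow h"
      then have "?o h = Suc (ow h - 1)" "ow h - 1 < n" using ext le[of h] by auto
      with h ow[OF h] show "ow h - 1 \<in> happy n m v ?A" by (auto simp: happy_def A)
    qed
    show "finite (happy n m v ?A)" by (rule finite_subset[of _ "{..<n}"]) (auto simp: happy_def)
  qed
qed

text \<open>The happy agents of any allocation, with their houses, form a matching along
  \<open>favourite\<close>, which \<open>auction_maximum\<close> bounds.\<close>

lemma happy_le_auction:
  assumes "auction_inv (favourite m v) m n p ow 0" "inj_on B (dom B)"
  shows "card (happy n m v B) \<le> card {h. h < m \<and> 0 < ow h}"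
proof (rule auction_maximum[OF assms(1)])
  show "inj_on (\<lambda>i. the (B i)) (happy n m v B)"
    using assms(2) by (auto simp: inj_on_def happy_def dom_def)
qed (auto simp: happy_def favourite_def)

text \<open>The number of houses sold in the auction separates the two sides: at most the happy
  agents of the output, at least those of any competitor \<open>B\<close>.\<close>

lemma fill_inv_optimal:
  assumes v: "house_instance {..<n} {..<m} v" and mn: "m \<le> n"
    and fill: "fill_inv n m ow n s" and auction: "auction_inv (favourite m v) m n p ow 0"
  shows "min_envy_complete {..<n} {..<m} v (output_allocation n s)"
  unfolding min_envy_complete_def
proof (intro conjI allI impI)
  let ?A = "output_allocation n s"
  note out = fill_inv_output[OF fill mn, of v]
  have ow: "\<And>h. h < m \<Longrightarrow> 0 < ow h \<Longrightarrow> favourite m v (ow h - 1) h \<and> (\<forall>g<m. ow g = ow h \<longrightarrow> g = h)"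
    using auction unfolding auction_inv_def by blast
  show A: "complete_allocation {..<n} {..<m} ?A" using out(1) ow by blast
  have happy_A: "card {h. h < m \<and> 0 < ow h} \<le> card (happy n m v ?A)" using out(2) ow by blast
  fix B assume B: "complete_allocation {..<n} {..<m} B"
  have envy: "num_envy {..<n} v C = card {i. i < n \<and> (\<exists>h<m. 0 < v i h)} - card (happy n m v C)"
    if "complete_allocation {..<n} {..<m} C" for C
    using num_envy_all_assigned[OF v _ complete_allocation_ran[OF that mn]] that
    by (simp add: complete_allocation_def)
  have "card (happy n m v B) \<le> card {h. h < m \<and> 0 < ow h}"
    using B by (intro happy_le_auction[OF auction]) (simp add: complete_allocation_def allocation_def)
  with happy_A show "num_envy {..<n} v ?A \<le> num_envy {..<n} v B"
    unfolding envy[OF A] envy[OF B] by (intro diff_le_mono2) linarith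
qed

lemma hoare_assign_houses:
  "\<exists>T. poly_bounded T \<and> (\<forall>n m v. hoare (T n m) (\<lambda>s. s = input_state n m v) assign_houses
     (\<lambda>s. \<exists>ow p. fill_inv n m ow n s \<and> auction_inv (favourite m v) m n p ow 0))"
proof -
  have "hoare (3 + Suc n * (3 + Suc m * (max_cost fill_step + 12) + 12))
    (\<lambda>s. \<exists>ow p. sizes n m s \<and> nmem s ''O'' = ow \<and> partial_inverse m ow (nmem s ''A'') \<and>
      auction_inv (favourite m v) m n p ow 0)
    fill
    (\<lambda>s. \<exists>ow p. fill_inv n m ow n s \<and> auction_inv (favourite m v) m n p ow 0)" for n m v
  \<comment> \<open>Fixing \<open>ow\<close> and \<open>p\<close> first lets the auction invariant,
    which does not mention the memory, survive the filling.\<close>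
  proof (rule hoareI, elim exE conjE)
    fix s ow p
    assume s: "sizes n m s" "nmem s ''O'' = ow" "partial_inverse m ow (nmem s ''A'')"
      and auction: "auction_inv (favourite m v) m n p ow 0"
    have "fill_inv n m ow 0 s"
      using s auction by (auto simp: fill_inv_def auction_inv_def)
    from hoareD[OF hoare_fill this] auction
    show "\<exists>t s'. exec fill s t s' \<and> t \<le> 3 + Suc n * (3 + Suc m * (max_cost fill_step + 12) + 12) \<and>
        (\<exists>ow p. fill_inv n m ow n s' \<and> auction_inv (favourite m v) m n p ow 0)"
      by blast
  qed
  note run = hoare_Seq[OF hoare_find_tops hoare_Seq[OF hoare_auction hoare_Seq[OF hoare_collect this]]]
  show ?thesis unfolding assign_houses_def
    \<comment> \<open>\<open>T\<close> stays schematic until \<open>run\<close> supplies it; its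
      polynomial bound is then read off its syntax.\<close>
    by (intro exI conjI allI, rule_tac [2] run) (intro poly_bounded_intros)
qed

theorem theorem4p2:
  "\<exists>(alg :: com) (p :: nat poly).
     \<forall>(n :: nat) (m :: nat) (v :: nat \<Rightarrow> nat \<Rightarrow> real).
       house_instance {..<n} {..<m} v \<and> m \<le> n \<longrightarrow>
         (\<exists>t s. exec alg (input_state n m v) t s \<and>
                t \<le> poly p (n + m) \<and>
                min_envy_complete {..<n} {..<m} v (output_allocation n s))"
proof -
  obtain T where T: "poly_bounded T" and run: "\<And>n m v. hoare (T n m)
      (\<lambda>s. s = input_state n m v) assign_houses
      (\<lambda>s. \<exists>ow p. fill_inv n m ow n s \<and> auction_inv (favourite m v) m n p ow 0)"
    using hoare_assign_houses by blast
  from T obtain p where p: "\<And>n m. T n m \<le> poly p (n + m)" unfolding poly_bounded_def by blast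
  show ?thesis
  proof (rule exI[of _ assign_houses], rule exI[of _ p], intro allI impI, elim conjE)
    fix n m :: nat and v :: "nat \<Rightarrow> nat \<Rightarrow> real"
    assume v: "house_instance {..<n} {..<m} v" "m \<le> n"
    from hoareD[OF run[of n m v] refl] obtain t s ow q where
      "exec assign_houses (input_state n m v) t s" "t \<le> T n m" "fill_inv n m ow n s"
      "auction_inv (favourite m v) m n q ow 0" by blast
    with v p show "\<exists>t s. exec assign_houses (input_state n m v) t s \<and> t \<le> poly p (n + m) \<and>
        min_envy_complete {..<n} {..<m} v (output_allocation n s)"
      by (meson fill_inv_optimal order_trans)
  qed
qed

end
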